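(* Under the setting described in the context, the filtered process $\hat\Theta_n=\mathbb{E}[\Theta_n\mid\mathcal{F}^N_n]$ satisfies, almost surely, $$\hat\Theta_n=\sum_{j\in\mathbb{J}}\frac{\widehat{(\tilde\Theta\lambda^j)}_{n-1}}{\hat\lambda^j_{n-1}}\,\mathbf 1_{[\Delta N_n=j]},\qquad\forall\, n=1,\dots,\Gamma.$$
   Context: Let $\Gamma\in\mathbb{N}$ and let $(\Omega,\mathbf{A},\mathbf F=(\mathcal{F}_n)_{n\in\{0,\dots,\Gamma\}},\mathbb{P})$ be a filtered probability space. $N$ is a discrete-time $\mathbf F$-adapted counting process with $N_0=0$; $\mathbf F^N=(\mathcal{F}^N_n)_n$ is its natural filtration augmented with the $\mathbb{P}$-null sets, and $\Delta N_n=N_n-N_{n-1}$ for $n\ge1$. $\mathbb{J}\subset\mathbb{N}$ denotes the support of the jumps $\Delta N_n$ (the set of their possible values, taken constant in time), with $0\in\mathbb{J}$. $\Theta=(\Theta_n)_{0\le n\le\Gamma}$ is a real-valued square integrable $\mathbf F$-adapted process such that, for every $n\ge1$, $\Theta_n$ and $\Delta N_n$ are independent conditionally on $\mathcal{F}_{n-1}$. It has a natural decomposition $\Theta_n=A_n+M_n$ with $A$ an $\mathbf F$-predictable square integrable process and $M$ a square integrable $\mathbf F$-martingale. ($\Theta$ is not assumed to be a Markov chain.) Notation: for $n\in\{1,\dots,\Gamma\}$ and $j\in\mathbb{J}$, $\tilde\Theta_{n-1}=\mathbb{E}[\Theta_n\mid\mathcal{F}_{n-1}]$, $\lambda^j_{n-1}=\mathbb{E}[\mathbf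 1_{[\Delta N_n=j]}\mid\mathcal{F}_{n-1}]$, $\hat\lambda^j_{n-1}=\mathbb{E}[\lambda^j_{n-1}\mid\mathcal{F}^N_{n-1}]$, and $\widehat{(\tilde\Theta\lambda^j)}_{n-1}=\mathbb{E}[\tilde\Theta_{n-1}\lambda^j_{n-1}\mid\mathcal{F}^N_{n-1}]$. A quotient with zero denominator is taken to be $0$ (almost surely this never occurs on the corresponding event $\{\Delta N_n=j\}$). *)

theory Defs
  imports "HOL-Probability.Probability"
begin

text \<open>
  Processes with time set \<open>{0..\<Gamma>}\<close> are functions on \<open>nat\<close>; every condition below is imposed only at
  times up to \<open>\<Gamma>\<close>, and values at later times are irrelevant.
\<close>

definition filtration_upto :: "'a measure \<Rightarrow> nat \<Rightarrow> (nat \<Rightarrow> 'a measure) \<Rightarrow> bool" where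
  "filtration_upto M \<Gamma> F \<longleftrightarrow>
     (\<forall>n\<le>\<Gamma>. subalgebra M (F n)) \<and>
     (\<forall>m n. m \<le> n \<longrightarrow> n \<le> \<Gamma> \<longrightarrow> subalgebra (F n) (F m))"

definition adapted_upto ::
  "nat \<Rightarrow> (nat \<Rightarrow> 'a measure) \<Rightarrow> 'b measure \<Rightarrow> (nat \<Rightarrow> 'a \<Rightarrow> 'b) \<Rightarrow> bool" where
  "adapted_upto \<Gamma> F S X \<longleftrightarrow> (\<forall>n\<le>\<Gamma>. X n \<in> measurable (F n) S)"

text \<open>Only \<open>\<F>\<^sub>0\<close>-measurability is asked at time \<open>0\<close>; in particular \<open>X 0 = 0\<close> is allowed.\<close>

definition predictable_upto ::
  "nat \<Rightarrow> (nat \<Rightarrow> 'a measure) \<Rightarrow> (nat \<Rightarrow> 'a \<Rightarrow> real) \<Rightarrow> bool" where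
  "predictable_upto \<Gamma> F X \<longleftrightarrow>
     X 0 \<in> borel_measurable (F 0) \<and> (\<forall>n\<in>{1..\<Gamma>}. X n \<in> borel_measurable (F (n - 1)))"

definition square_integrable_upto ::
  "'a measure \<Rightarrow> nat \<Rightarrow> (nat \<Rightarrow> 'a \<Rightarrow> real) \<Rightarrow> bool" where
  "square_integrable_upto M \<Gamma> X \<longleftrightarrow>
     (\<forall>n\<le>\<Gamma>. X n \<in> borel_measurable M \<and> integrable M (\<lambda>\<omega>. (X n \<omega>)\<^sup>2))"

definition martingale_upto ::
  "'a measure \<Rightarrow> nat \<Rightarrow> (nat \<Rightarrow> 'a measure) \<Rightarrow> (nat \<Rightarrow> 'a \<Rightarrow> real) \<Rightarrow> bool" where
  "martingale_upto M \<Gamma> F X \<longleftrightarrow>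
     adapted_upto \<Gamma> F borel X \<and>
     (\<forall>n\<le>\<Gamma>. integrable M (X n)) \<and>
     (\<forall>m n. m \<le> n \<longrightarrow> n \<le> \<Gamma> \<longrightarrow> (AE \<omega> in M. real_cond_exp M (F m) (X n) \<omega> = X m \<omega>))"

definition counting_process_upto ::
  "'a measure \<Rightarrow> nat \<Rightarrow> (nat \<Rightarrow> 'a measure) \<Rightarrow> (nat \<Rightarrow> 'a \<Rightarrow> nat) \<Rightarrow> bool" where
  "counting_process_upto M \<Gamma> F N \<longleftrightarrow>
     adapted_upto \<Gamma> F (count_space UNIV) N \<and>
     (\<forall>\<omega>\<in>space M. N 0 \<omega> = 0) \<and>
     (\<forall>\<omega>\<in>space M. \<forall>n\<in>{1..\<Gamma>}. N (n - 1) \<omega> \<le> N n \<omega>)"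

text \<open>Truncated subtraction is harmless because counting processes are nondecreasing.\<close>

definition jump :: "(nat \<Rightarrow> 'a \<Rightarrow> nat) \<Rightarrow> nat \<Rightarrow> 'a \<Rightarrow> nat" where
  "jump N n \<omega> = N n \<omega> - N (n - 1) \<omega>"

definition discrete_support :: "'a measure \<Rightarrow> ('a \<Rightarrow> nat) \<Rightarrow> nat set" where
  "discrete_support M X = {j. measure M {\<omega> \<in> space M. X \<omega> = j} > 0}"

text \<open>
  The null sets are the measurable ones, so the result is a sub-\<open>\<sigma>\<close>-algebra of \<open>M\<close> whether or not
  \<open>M\<close> is complete.
\<close>

definition augmented_natural_filtration ::
  "'a measure \<Rightarrow> (nat \<Rightarrow> 'a \<Rightarrow> nat) \<Rightarrow> nat \<Rightarrow> 'a measure" where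
  "augmented_natural_filtration M N n =
     sigma (space M) ({N k -` B \<inter> space M | k B. k \<le> n} \<union> null_sets M)"

definition cond_indep_var ::
  "'a measure \<Rightarrow> 'a measure \<Rightarrow> 'b measure \<Rightarrow> ('a \<Rightarrow> 'b) \<Rightarrow> 'c measure \<Rightarrow> ('a \<Rightarrow> 'c) \<Rightarrow> bool" where
  "cond_indep_var M G S X T Y \<longleftrightarrow>
     X \<in> measurable M S \<and> Y \<in> measurable M T \<and>
     (\<forall>B\<in>sets S. \<forall>C\<in>sets T. AE \<omega> in M.
        real_cond_exp M G (indicator {\<omega> \<in> space M. X \<omega> \<in> B \<and> Y \<omega> \<in> C}) \<omega> =
        real_cond_exp M G (indicator {\<omega> \<in> space M. X \<omega> \<in> B}) \<omega> *
        real_cond_exp M G (indicator {\<omega> \<in> space M. Y \<omega> \<in> C}) \<omega>)"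

text \<open>
  The argument \<open>m\<close> of the following functions is the subscript \<open>n - 1\<close> of \<open>\<Theta>\<close>-tilde and \<open>\<lambda>\<^sup>j\<close>, so
  that the predicted quantities are those at time \<open>Suc m\<close>.
\<close>

definition predicted ::
  "'a measure \<Rightarrow> (nat \<Rightarrow> 'a measure) \<Rightarrow> (nat \<Rightarrow> 'a \<Rightarrow> real) \<Rightarrow> nat \<Rightarrow> 'a \<Rightarrow> real" where
  "predicted M F \<Theta> m = real_cond_exp M (F m) (\<Theta> (Suc m))"

definition jump_intensity ::
  "'a measure \<Rightarrow> (nat \<Rightarrow> 'a measure) \<Rightarrow> (nat \<Rightarrow> 'a \<Rightarrow> nat) \<Rightarrow> nat \<Rightarrow> nat \<Rightarrow> 'a \<Rightarrow> real" where
  "jump_intensity M F N j m =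
     real_cond_exp M (F m) (indicator {\<omega> \<in> space M. jump N (Suc m) \<omega> = j})"

definition filtered ::
  "'a measure \<Rightarrow> (nat \<Rightarrow> 'a \<Rightarrow> nat) \<Rightarrow> (nat \<Rightarrow> 'a \<Rightarrow> real) \<Rightarrow> nat \<Rightarrow> 'a \<Rightarrow> real" where
  "filtered M N X m = real_cond_exp M (augmented_natural_filtration M N m) (X m)"

end

theory Submission
  imports Defs
begin

text \<open>
  On the event \<open>D\<close> that the jump at time \<open>n\<close> equals \<open>j\<close>, observing \<open>N\<close> up to time \<open>n\<close> tells no more
  than observing it up to time \<open>n - 1\<close>, so \<open>\<F>\<^sup>N\<^sub>n\<close> and \<open>\<F>\<^sup>N\<^sub>n\<^sub>-\<^sub>1\<close> have the same trace on \<open>D\<close>.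
  Hence on \<open>D\<close> Bayes' formula gives \<open>E[\<Theta>\<^sub>n | \<F>\<^sup>N\<^sub>n] = E[\<Theta>\<^sub>n 1\<^sub>D | \<F>\<^sup>N\<^sub>n\<^sub>-\<^sub>1] / E[1\<^sub>D | \<F>\<^sup>N\<^sub>n\<^sub>-\<^sub>1]\<close>.
  Numerator and denominator are computed by first conditioning on \<open>\<F>\<^sub>n\<^sub>-\<^sub>1\<close>, where conditional
  independence factors \<open>E[\<Theta>\<^sub>n 1\<^sub>D | \<F>\<^sub>n\<^sub>-\<^sub>1]\<close>.
\<close>

section \<open>Conditional expectations: integral tests, bounds and nested conditioning\<close>

text \<open>Writes the test over a set as an integral of a product with its indicator, the form in
  which measurable weights can be moved through \<open>real_cond_exp_intg\<close>.\<close>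

lemma (in sigma_finite_subalgebra) real_cond_exp_charact_indicator:
  assumes "\<And>B. B \<in> sets F \<Longrightarrow> (\<integral>x. indicator B x * f x \<partial>M) = (\<integral>x. indicator B x * g x \<partial>M)"
    and "integrable M f" "integrable M g" "g \<in> borel_measurable F"
  shows "AE x in M. real_cond_exp M F f x = g x"
proof (rule real_cond_exp_charact)
  fix B assume "B \<in> sets F"
  then show "(\<integral>x\<in>B. f x \<partial>M) = (\<integral>x\<in>B. g x \<partial>M)"
    using assms(1) by (simp add: set_lebesgue_integral_def)
qed (fact assms)+

lemma (in sigma_finite_subalgebra) real_cond_exp_intg_indicator:
  assumes f: "integrable M f" and B: "B \<in> sets F"
  shows "(\<integral>x. indicator B x * real_cond_exp M F f x \<partial>M) = (\<integral>x. indicator B x * f x \<partial>M)"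
  using real_cond_exp_intA[OF f B] by (simp add: set_lebesgue_integral_def)

text \<open>The weights \<open>c\<close> in use are indicators and conditional probabilities; the
  latter are bounded by 1 only almost everywhere.\<close>

lemma integrable_mult_AE_le_1:
  fixes f c :: "'a \<Rightarrow> real"
  assumes f: "integrable M f" and c: "c \<in> borel_measurable M" "AE x in M. \<bar>c x\<bar> \<le> 1"
  shows "integrable M (\<lambda>x. c x * f x)"
proof (rule Bochner_Integration.integrable_bound[OF f])
  show "(\<lambda>x. c x * f x) \<in> borel_measurable M" using f c by measurable
  show "AE x in M. norm (c x * f x) \<le> norm (f x)"
    using c(2) by eventually_elim (auto simp: abs_mult intro: mult_left_le_one_le)
qed

lemma (in prob_space) sigma_finite_subalgebraI:
  assumes "subalgebra M F"
  shows "sigma_finite_subalgebra M F"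
proof -
  interpret finite_measure_subalgebra M F by unfold_locales (fact assms)
  show ?thesis by unfold_locales
qed

lemma (in prob_space) real_cond_exp_indicator_bounds:
  assumes F: "subalgebra M F" and D: "D \<in> sets M"
  shows "AE x in M. \<bar>real_cond_exp M F (indicator D) x\<bar> \<le> 1"
proof -
  interpret F: sigma_finite_subalgebra M F by (rule sigma_finite_subalgebraI[OF F])
  have i: "integrable M (indicator D :: 'a \<Rightarrow> real)" using D by (simp add: less_top[symmetric])
  have "AE x in M. real_cond_exp M F (indicator D) x \<ge> 0"
    by (rule F.real_cond_exp_ge_c[OF i]) (auto simp: indicator_def)
  moreover have "AE x in M. real_cond_exp M F (indicator D) x \<le> 1"
    by (rule F.real_cond_exp_le_c[OF i]) (auto simp: indicator_def)
  ultimately show ?thesis by eventually_elim auto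
qed

text \<open>
  The tower property when \<open>G\<close> is contained in \<open>F\<close> only up to null sets: the augmented natural
  filtration of \<open>N\<close> need not be contained in the given filtration.
\<close>

lemma (in prob_space) real_cond_exp_nested_mod_null:
  fixes f :: "'a \<Rightarrow> real"
  assumes F: "subalgebra M F" and G: "subalgebra M G"
    and FG: "\<And>B. B \<in> sets G \<Longrightarrow> \<exists>B'\<in>sets F. AE x in M. x \<in> B \<longleftrightarrow> x \<in> B'"
    and f: "integrable M f"
  shows "AE x in M. real_cond_exp M G (real_cond_exp M F f) x = real_cond_exp M G f x"
proof -
  interpret F: sigma_finite_subalgebra M F by (rule sigma_finite_subalgebraI[OF F])
  interpret G: sigma_finite_subalgebra M G by (rule sigma_finite_subalgebraI[OF G])
  have Ff: "integrable M (real_cond_exp M F f)" by (rule F.real_cond_exp_int(1)[OF f])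
  show ?thesis
  proof (rule G.real_cond_exp_charact_indicator)
    fix B assume B: "B \<in> sets G"
    obtain B' where B': "B' \<in> sets F" "AE x in M. x \<in> B \<longleftrightarrow> x \<in> B'" using FG[OF B] by blast
    have [measurable]: "B \<in> sets M" "B' \<in> sets M" "f \<in> borel_measurable M"
      using B B'(1) F G f by (auto simp: subalgebra_def)
    \<comment> \<open>\<open>B\<close> itself may fail to lie in \<open>F\<close>, so the defining
      identity of \<open>real_cond_exp M F f\<close> is applied to \<open>B'\<close>; the passage to
      \<open>B'\<close> and back changes the integrals only on null sets.\<close>
    have "(\<integral>x. indicator B x * real_cond_exp M F f x \<partial>M)
        = (\<integral>x. indicator B' x * real_cond_exp M F f x \<partial>M)"
      by (rule integral_cong_AE) (use B'(2) in \<open>auto simp: indicator_def\<close>)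
    also have "\<dots> = (\<integral>x. indicator B' x * f x \<partial>M)"
      by (rule F.real_cond_exp_intg_indicator[OF f B'(1)])
    also have "\<dots> = (\<integral>x. indicator B x * f x \<partial>M)"
      by (rule integral_cong_AE) (use B'(2) in \<open>auto simp: indicator_def\<close>)
    also have "\<dots> = (\<integral>x. indicator B x * real_cond_exp M G f x \<partial>M)"
      by (rule G.real_cond_exp_intg_indicator[OF f B, symmetric])
    finally show "(\<integral>x. indicator B x * real_cond_exp M F f x \<partial>M)
        = (\<integral>x. indicator B x * real_cond_exp M G f x \<partial>M)" .
  qed (use Ff G.real_cond_exp_int(1)[OF f] in auto)
qed

section \<open>Bayes' formula on an event where two \<sigma>-algebras have the same trace\<close>

text \<open>With \<open>a\<close> the numerator and \<open>b\<close> the denominator, the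
  quotient-free identity \<open>b * E[f | H] = a\<close> on \<open>D\<close> comes first. Division
  is then legitimate because \<open>b\<close> vanishes almost nowhere on \<open>D\<close>.\<close>

lemma (in prob_space) real_cond_exp_bayes_trace:
  fixes f :: "'a \<Rightarrow> real"
  assumes G: "subalgebra M G" and H: "subalgebra M H" and GH: "subalgebra H G"
    and D: "D \<in> sets H"
    and trace: "\<And>C. C \<in> sets H \<Longrightarrow> \<exists>B\<in>sets G. C \<inter> D = B \<inter> D"
    and f: "integrable M f"
  shows "AE x in M. x \<in> D \<longrightarrow> real_cond_exp M H f x =
    real_cond_exp M G (\<lambda>x. indicator D x * f x) x / real_cond_exp M G (indicator D) x"
proof -
  interpret G: sigma_finite_subalgebra M G by (rule sigma_finite_subalgebraI[OF G])
  interpret H: sigma_finite_subalgebra M H by (rule sigma_finite_subalgebraI[OF H])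
  define a where "a = real_cond_exp M G (\<lambda>x. indicator D x * f x)"
  define b where "b = real_cond_exp M G (indicator D)"
  have [measurable]: "D \<in> sets M" using D H by (auto simp: subalgebra_def)
  have iD: "integrable M (indicator D :: 'a \<Rightarrow> real)" by (simp add: less_top[symmetric])
  have Df: "integrable M (\<lambda>x. indicator D x * f x)"
    by (rule integrable_mult_AE_le_1[OF f]) (auto simp: indicator_def)
  have a: "integrable M a" unfolding a_def by (rule G.real_cond_exp_int(1)[OF Df])
  have [measurable]: "a \<in> borel_measurable G" "b \<in> borel_measurable G"
    "a \<in> borel_measurable M" "b \<in> borel_measurable M" "f \<in> borel_measurable M"
    using f by (auto simp: a_def b_def)
  have [measurable]: "a \<in> borel_measurable H" "b \<in> borel_measurable H" "D \<in> sets H"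
    using D by (auto intro: measurable_from_subalg[OF GH])
  have b1: "AE x in M. \<bar>b x\<bar> \<le> 1"
    unfolding b_def by (rule real_cond_exp_indicator_bounds[OF G]) simp
  have bDf: "integrable M (\<lambda>x. b x * (indicator D x * f x))"
    by (rule integrable_mult_AE_le_1[OF Df _ b1]) simp
  have aD: "integrable M (\<lambda>x. indicator D x * a x)"
    by (rule integrable_mult_AE_le_1[OF a]) (auto simp: indicator_def)

  \<comment> \<open>Both sides carry the factor \<open>indicator D\<close>, so a test set
    \<open>C\<close> of \<open>H\<close> can be exchanged for a set \<open>B\<close> of
    \<open>G\<close> with the same trace on \<open>D\<close>.\<close>
  have "AE x in M. real_cond_exp M H (\<lambda>x. b x * indicator D x * f x) x = indicator D x * a x"
  proof (rule H.real_cond_exp_charact_indicator)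
    fix C assume C: "C \<in> sets H"
    obtain B where B: "B \<in> sets G" and CB: "C \<inter> D = B \<inter> D" using trace[OF C] by blast
    have [measurable]: "B \<in> sets G" "B \<in> sets M" using B G by (auto simp: subalgebra_def)
    have Bb: "integrable M (\<lambda>x. (indicator B x * b x) * (indicator D x * f x))"
      by (rule integrable_mult_AE_le_1[OF Df])
        (use b1 in \<open>auto simp: indicator_def elim: eventually_mono\<close>)
    have Ba: "integrable M (\<lambda>x. (indicator B x * a x) * indicator D x)"
      using integrable_real_mult_indicator[of B M, OF _ aD] by (simp add: mult_ac)
    have "(\<integral>x. indicator C x * (b x * indicator D x * f x) \<partial>M)
        = (\<integral>x. (indicator B x * b x) * (indicator D x * f x) \<partial>M)"
      by (rule Bochner_Integration.integral_cong)
        (use CB in \<open>auto simp: indicator_def split: if_splits\<close>)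
    also have "\<dots> = (\<integral>x. (indicator B x * b x) * a x \<partial>M)"
      unfolding a_def by (rule G.real_cond_exp_intg(2)[symmetric, OF Bb]) auto
    \<comment> \<open>\<open>a\<close> and \<open>b\<close> change roles: \<open>a\<close> has just
      replaced \<open>indicator D * f\<close>, and now counts as a \<open>G\<close>-measurable
      weight, so that \<open>b\<close> can be turned back into \<open>indicator D\<close>.\<close>
    also have "\<dots> = (\<integral>x. (indicator B x * a x) * b x \<partial>M)" by (simp add: mult_ac)
    also have "\<dots> = (\<integral>x. (indicator B x * a x) * indicator D x \<partial>M)"
      unfolding b_def by (rule G.real_cond_exp_intg(2)[OF Ba]) auto
    also have "\<dots> = (\<integral>x. indicator C x * (indicator D x * a x) \<partial>M)"
      by (rule Bochner_Integration.integral_cong)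
        (use CB in \<open>auto simp: indicator_def split: if_splits\<close>)
    finally show "(\<integral>x. indicator C x * (b x * indicator D x * f x) \<partial>M)
        = (\<integral>x. indicator C x * (indicator D x * a x) \<partial>M)" .
  qed (use bDf aD in \<open>auto simp: mult_ac\<close>)
  moreover have "AE x in M. real_cond_exp M H (\<lambda>x. b x * indicator D x * f x) x
      = b x * indicator D x * real_cond_exp M H f x"
    by (rule H.real_cond_exp_mult) (use bDf in \<open>auto simp: mult_ac\<close>)
  \<comment> \<open>The zero set \<open>Z\<close> of \<open>b\<close> belongs to \<open>G\<close>,
    so the probability of \<open>Z \<inter> D\<close> is the integral of \<open>b\<close> over
    \<open>Z\<close>, which is 0.\<close>
  moreover have "AE x in M. \<not> (x \<in> D \<and> b x = 0)"
  proof -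
    define Z where "Z = {x \<in> space M. b x = 0}"
    have "Z = {x \<in> space G. b x = 0}" using G by (simp add: Z_def subalgebra_def)
    then have Z: "Z \<in> sets G" by simp
    then have [measurable]: "Z \<in> sets M" using G by (auto simp: subalgebra_def)
    have "measure M (Z \<inter> D) = (\<integral>x. indicator Z x * indicator D x \<partial>M)"
      by (simp flip: indicator_inter_arith)
    also have "\<dots> = (\<integral>x. indicator Z x * b x \<partial>M)"
      unfolding b_def by (rule G.real_cond_exp_intg_indicator[OF iD Z, symmetric])
    also have "\<dots> = (\<integral>x. 0 \<partial>M)"
      by (rule Bochner_Integration.integral_cong) (auto simp: Z_def indicator_def)
    finally have "prob (Z \<inter> D) = 0" by simp
    then have "AE x in M. x \<notin> Z \<inter> D"
      by (subst (asm) prob_eq_0) auto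
    with AE_space show ?thesis by eventually_elim (auto simp: Z_def)
  qed
  ultimately show ?thesis
    unfolding a_def[symmetric] b_def[symmetric]
    by eventually_elim (auto simp: field_simps)
qed

section \<open>Factorisation of conditional expectations under conditional independence\<close>

text \<open>
  With \<open>l = E[1\<^sub>D | G]\<close> and \<open>B \<in> G\<close>, independence on events says that \<open>1\<^sub>B (1\<^sub>D - l)\<close> has conditional
  expectation zero given \<open>X\<close>; it is therefore orthogonal to \<open>X\<close> itself, without approximating \<open>X\<close>
  by simple functions.
\<close>

lemma (in prob_space) cond_indep_var_real_cond_exp_mult:
  fixes X :: "'a \<Rightarrow> real"
  assumes G: "subalgebra M G" and ind: "cond_indep_var M G borel X T Y"
    and X: "integrable M X" and C: "C \<in> sets T"
  defines "D \<equiv> {\<omega> \<in> space M. Y \<omega> \<in> C}"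
  shows "AE x in M. real_cond_exp M G (\<lambda>x. indicator D x * X x) x
      = real_cond_exp M G X x * real_cond_exp M G (indicator D) x"
proof -
  interpret G: sigma_finite_subalgebra M G by (rule sigma_finite_subalgebraI[OF G])
  define l where "l = real_cond_exp M G (indicator D)"
  have [measurable]: "X \<in> borel_measurable M" "Y \<in> measurable M T" "C \<in> sets T"
    using ind C by (auto simp: cond_indep_var_def)
  have [measurable]: "D \<in> sets M" unfolding D_def by measurable
  have iD: "integrable M (indicator D :: 'a \<Rightarrow> real)" by (simp add: less_top[symmetric])
  have [measurable]: "l \<in> borel_measurable G" "l \<in> borel_measurable M" by (auto simp: l_def)
  have l: "integrable M l" unfolding l_def by (rule G.real_cond_exp_int(1)[OF iD])
  have l1: "AE x in M. \<bar>l x\<bar> \<le> 1"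
    unfolding l_def by (rule real_cond_exp_indicator_bounds[OF G]) simp
  have DX: "integrable M (\<lambda>x. indicator D x * X x)"
    by (rule integrable_mult_AE_le_1[OF X]) (auto simp: indicator_def)
  have lX: "integrable M (\<lambda>x. l x * X x)"
    by (rule integrable_mult_AE_le_1[OF X _ l1]) simp
  have lEX: "integrable M (\<lambda>x. l x * real_cond_exp M G X x)"
    by (rule G.real_cond_exp_intg(1)[OF lX]) auto

  have main: "(\<integral>x. indicator B x * (indicator D x * X x) \<partial>M)
      = (\<integral>x. indicator B x * (l x * real_cond_exp M G X x) \<partial>M)" if B: "B \<in> sets G" for B
  proof -
    have [measurable]: "B \<in> sets G" "B \<in> sets M" using B G by (auto simp: subalgebra_def)
    define g where "g x = indicator B x * (indicator D x - l x)" for x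
    have [measurable]: "g \<in> borel_measurable M" unfolding g_def by measurable
    have g: "integrable M g"
      unfolding g_def
      by (rule integrable_mult_AE_le_1[OF Bochner_Integration.integrable_diff[OF iD l]])
        (auto simp: indicator_def)
    \<comment> \<open>This is the \<sigma>-algebra generated by \<open>X\<close>. All its members
      are events \<open>X \<in> U\<close>, exactly those to which the conditional independence
      hypothesis applies.\<close>
    define S where "S = vimage_algebra (space M) X (borel :: real measure)"
    have S: "subalgebra M S"
      by (auto simp: S_def subalgebra_def sets_vimage_algebra2)
    interpret S: sigma_finite_subalgebra M S by (rule sigma_finite_subalgebraI[OF S])
    have XS: "X \<in> borel_measurable S"
      unfolding S_def by (rule measurable_vimage_algebra1) auto
    have gS: "AE x in M. real_cond_exp M S g x = 0"
    proof (rule S.real_cond_exp_charact_indicator)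
      fix E assume ES: "E \<in> sets S"
      then obtain U where U: "U \<in> sets borel" "E = X -` U \<inter> space M"
        by (auto simp: S_def sets_vimage_algebra2)
      then have E: "E = {\<omega> \<in> space M. X \<omega> \<in> U}" by auto
      have [measurable]: "E \<in> sets M" using ES S by (auto simp: subalgebra_def)
      have ED: "{\<omega> \<in> space M. X \<omega> \<in> U \<and> Y \<omega> \<in> C} = E \<inter> D" by (auto simp: E D_def)
      have fac: "AE x in M. real_cond_exp M G (indicator (E \<inter> D)) x
          = real_cond_exp M G (indicator E) x * l x"
        using ind U(1) C unfolding cond_indep_var_def l_def ED[symmetric] unfolding E D_def by blast
      have iE: "integrable M (indicator E :: 'a \<Rightarrow> real)"
        and iED: "integrable M (indicator (E \<inter> D) :: 'a \<Rightarrow> real)" by (simp_all add: less_top[symmetric])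
      have BlE: "integrable M (\<lambda>x. (indicator B x * l x) * indicator E x)"
        by (intro integrable_real_mult_indicator)
          (use integrable_real_mult_indicator[of B M, OF _ l] in \<open>simp_all add: mult.commute\<close>)
      \<comment> \<open>Conditioning on \<open>G\<close> makes the factorisation \<open>fac\<close>
        available. Afterwards \<open>indicator B * l\<close> is a \<open>G\<close>-measurable
        weight, so the conditional probability of \<open>E\<close> reverts to its indicator.\<close>
      have "(\<integral>x. indicator B x * indicator (E \<inter> D) x \<partial>M)
          = (\<integral>x. indicator B x * real_cond_exp M G (indicator (E \<inter> D)) x \<partial>M)"
        by (rule G.real_cond_exp_intg_indicator[OF iED B, symmetric])
      also have "\<dots> = (\<integral>x. (indicator B x * l x) * real_cond_exp M G (indicator E) x \<partial>M)"
        by (rule integral_cong_AE) (use fac in \<open>auto elim!: eventually_mono\<close>)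
      also have "\<dots> = (\<integral>x. (indicator B x * l x) * indicator E x \<partial>M)"
        by (rule G.real_cond_exp_intg(2)[OF BlE]) auto
      finally have eq: "(\<integral>x. indicator B x * indicator (E \<inter> D) x \<partial>M)
          = (\<integral>x. (indicator B x * l x) * indicator E x \<partial>M)" .
      have BED: "integrable M (\<lambda>x. indicator B x * indicator (E \<inter> D) x :: real)"
        by (simp add: less_top[symmetric] flip: indicator_inter_arith)
      have "(\<integral>x. indicator E x * g x \<partial>M) = (\<integral>x. indicator B x * indicator (E \<inter> D) x
          - (indicator B x * l x) * indicator E x \<partial>M)"
        by (rule Bochner_Integration.integral_cong) (auto simp: g_def indicator_def)
      also have "\<dots> = 0"
        by (subst Bochner_Integration.integral_diff[OF BED BlE]) (simp add: eq)
      finally show "(\<integral>x. indicator E x * g x \<partial>M) = (\<integral>x. indicator E x * 0 \<partial>M)" by simp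
    qed (use g in auto)
    have BDX: "integrable M (\<lambda>x. indicator B x * (indicator D x * X x))"
      using integrable_real_mult_indicator[of B M, OF _ DX] by (simp add: mult.commute)
    have BlX: "integrable M (\<lambda>x. (indicator B x * l x) * X x)"
      using integrable_real_mult_indicator[of B M, OF _ lX] by (simp add: mult_ac)
    have Xg_eq: "X x * g x = indicator B x * (indicator D x * X x) - (indicator B x * l x) * X x" for x
      by (simp add: g_def algebra_simps)
    have Xg: "integrable M (\<lambda>x. X x * g x)"
      unfolding Xg_eq using BDX BlX by (rule Bochner_Integration.integrable_diff)
    \<comment> \<open>\<open>X\<close> is \<open>S\<close>-measurable and \<open>X * g\<close> is
      integrable, so an unbounded \<open>X\<close> may serve as the test function.\<close>
    have "(\<integral>x. X x * g x \<partial>M) = (\<integral>x. X x * real_cond_exp M S g x \<partial>M)"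
      by (rule S.real_cond_exp_intg(2)[OF Xg XS, symmetric]) simp
    also have "\<dots> = (\<integral>x. 0 \<partial>M)"
      by (rule integral_cong_AE) (use gS in auto)
    finally have "(\<integral>x. X x * g x \<partial>M) = 0" by simp
    then have "(\<integral>x. indicator B x * (indicator D x * X x) \<partial>M) = (\<integral>x. (indicator B x * l x) * X x \<partial>M)"
      unfolding Xg_eq by (subst (asm) Bochner_Integration.integral_diff[OF BDX BlX]) simp
    \<comment> \<open>The remaining weight is \<open>G\<close>-measurable, which allows
      \<open>X\<close> to be replaced by its conditional expectation.\<close>
    also have "\<dots> = (\<integral>x. (indicator B x * l x) * real_cond_exp M G X x \<partial>M)"
      by (rule G.real_cond_exp_intg(2)[OF BlX, symmetric]) auto
    finally show ?thesis by (simp add: mult.assoc)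
  qed
  show "AE x in M. real_cond_exp M G (\<lambda>x. indicator D x * X x) x
      = real_cond_exp M G X x * real_cond_exp M G (indicator D) x"
    unfolding l_def[symmetric]
    by (rule G.real_cond_exp_charact_indicator[OF _ DX])
      (use main lEX in \<open>auto simp: mult_ac\<close>)
qed

section \<open>The augmented natural filtration: measurability, null sets and traces\<close>

lemma sets_augmented_natural_filtration:
  "sets (augmented_natural_filtration M N n)
    = sigma_sets (space M) ({N k -` B \<inter> space M | k B. k \<le> n} \<union> null_sets M)"
  unfolding augmented_natural_filtration_def
  by (rule sets_measure_of) (auto dest: sets.sets_into_space null_setsD2)

lemma space_augmented_natural_filtration:
  "space (augmented_natural_filtration M N n) = space M"
  unfolding augmented_natural_filtration_def by (rule space_measure_of_conv)

lemma subalgebra_augmented_natural_filtration: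
  assumes N: "\<And>k. k \<le> n \<Longrightarrow> N k \<in> measurable M (count_space UNIV)"
  shows "subalgebra M (augmented_natural_filtration M N n)"
proof -
  have "sigma_sets (space M) ({N k -` B \<inter> space M | k B. k \<le> n} \<union> null_sets M) \<subseteq> sets M"
    using N by (intro sets.sigma_sets_subset) (auto simp: measurable_def)
  then show ?thesis
    by (simp add: subalgebra_def sets_augmented_natural_filtration space_augmented_natural_filtration)
qed

lemma subalgebra_augmented_natural_filtration_mono:
  assumes "m \<le> n"
  shows "subalgebra (augmented_natural_filtration M N n) (augmented_natural_filtration M N m)"
  unfolding subalgebra_def space_augmented_natural_filtration sets_augmented_natural_filtration
  using assms by (auto intro!: sigma_sets_mono' intro: order_trans)

lemma measurable_augmented_natural_filtration:
  assumes "k \<le> n"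
  shows "N k \<in> measurable (augmented_natural_filtration M N n) (count_space UNIV)"
  using assms
  by (auto simp: measurable_def space_augmented_natural_filtration
      sets_augmented_natural_filtration intro!: sigma_sets.Basic)

text \<open>The sets that agree almost everywhere with a member of \<open>F\<close> form a
  \<sigma>-algebra. It contains the events of \<open>N\<close> up to time \<open>n\<close>, which
  lie in \<open>F\<close>, and the null sets, which are matched with the empty set.\<close>

lemma augmented_natural_filtration_mod_null:
  assumes F: "subalgebra M F" and N: "\<And>k. k \<le> n \<Longrightarrow> N k \<in> measurable F (count_space UNIV)"
    and B: "B \<in> sets (augmented_natural_filtration M N n)"
  shows "\<exists>B'\<in>sets F. AE x in M. x \<in> B \<longleftrightarrow> x \<in> B'"
proof -
  have sp: "space F = space M" using F by (simp add: subalgebra_def)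
  show ?thesis
    using B unfolding sets_augmented_natural_filtration
  proof (induction rule: sigma_sets.induct)
    case (Basic B)
    then consider k U where "k \<le> n" "B = N k -` U \<inter> space M" | "B \<in> null_sets M" by auto
    then show ?case
    proof cases
      case 1
      then have "B \<in> sets F" using measurable_sets[OF N, of k U] by (simp add: sp)
      then show ?thesis by auto
    next
      case 2
      then show ?thesis by (intro bexI[of _ "{}"]) (auto dest: AE_not_in)
    qed
  next
    case Empty
    then show ?case by (intro bexI[of _ "{}"]) auto
  next
    case (Compl B)
    then obtain B' where "B' \<in> sets F" "AE x in M. x \<in> B \<longleftrightarrow> x \<in> B'" by blast
    moreover from this have "AE x in M. x \<in> space M - B \<longleftrightarrow> x \<in> space F - B'"
      by (auto simp: sp)
    ultimately show ?case by (meson sets.compl_sets)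
  next
    case (Union A)
    then obtain A' where A': "\<And>i. A' i \<in> sets F" "\<And>i::nat. AE x in M. x \<in> A i \<longleftrightarrow> x \<in> A' i" by metis
    \<comment> \<open>Countably many exceptional null sets are merged into one before the union is
      taken.\<close>
    then have "AE x in M. \<forall>i. x \<in> A i \<longleftrightarrow> x \<in> A' i" by (simp add: AE_all_countable)
    then have "AE x in M. x \<in> (\<Union>i. A i) \<longleftrightarrow> x \<in> (\<Union>i. A' i)" by eventually_elim auto
    with A'(1) show ?case by (intro bexI[of _ "\<Union>i. A' i"]) auto
  qed
qed

text \<open>The sets whose trace on \<open>D\<close> is that of a set known at time \<open>m\<close>
  form a \<sigma>-algebra, so generators suffice. Events of earlier values and null sets are already
  known at time \<open>m\<close>; only the value at time \<open>Suc m\<close> is new, and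
  \<open>D\<close> determines it from \<open>N m\<close>.\<close>

lemma augmented_natural_filtration_trace:
  fixes N :: "nat \<Rightarrow> 'a \<Rightarrow> nat" and j :: nat
  assumes mono: "\<And>\<omega>. \<omega> \<in> space M \<Longrightarrow> N m \<omega> \<le> N (Suc m) \<omega>"
    and C: "C \<in> sets (augmented_natural_filtration M N (Suc m))"
  defines "D \<equiv> {\<omega> \<in> space M. jump N (Suc m) \<omega> = j}"
  shows "\<exists>B\<in>sets (augmented_natural_filtration M N m). C \<inter> D = B \<inter> D"
proof -
  let ?G = "augmented_natural_filtration M N m"
  note sG = sets_augmented_natural_filtration[of M N m]
  show ?thesis
    using C[unfolded sets_augmented_natural_filtration[of M N "Suc m"]]
  proof (induction rule: sigma_sets.induct)
    case (Basic B)
    then consider k U where "k \<le> m" "B = N k -` U \<inter> space M"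
      | U where "B = N (Suc m) -` U \<inter> space M" | "B \<in> null_sets M"
      by (auto simp: le_Suc_eq)
    then show ?case
    proof cases
      case 1
      then have "B \<in> sets ?G" by (auto simp: sG)
      then show ?thesis by (rule rev_bexI) (rule refl)
    next
      case 2
      \<comment> \<open>Monotonicity matters for \<open>j = 0\<close>: a decrease would also give
        the truncated difference 0.\<close>
      have "N (Suc m) \<omega> = N m \<omega> + j" if "\<omega> \<in> D" for \<omega>
        using that mono[of \<omega>] by (auto simp: D_def jump_def)
      then have "B \<inter> D = (N m -` {x. x + j \<in> U} \<inter> space M) \<inter> D"
        unfolding 2 by auto
      moreover have "N m -` {x. x + j \<in> U} \<inter> space M \<in> sets ?G"
        unfolding sG by (rule sigma_sets.Basic) blast
      ultimately show ?thesis by (rule rev_bexI[rotated])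
    next
      case 3
      then have "B \<in> sets ?G" by (auto simp: sG)
      then show ?thesis by (rule rev_bexI) (rule refl)
    qed
  next
    case Empty
    then show ?case by (intro bexI[of _ "{}"]) auto
  next
    case (Compl B)
    then obtain B' where B': "B' \<in> sets ?G" "B \<inter> D = B' \<inter> D" by blast
    then have "(space M - B) \<inter> D = (space ?G - B') \<inter> D"
      unfolding space_augmented_natural_filtration by blast
    with B'(1) show ?case by (meson sets.compl_sets)
  next
    case (Union A)
    then obtain A' where A': "\<And>i. A' i \<in> sets ?G" "\<And>i::nat. A i \<inter> D = A' i \<inter> D" by metis
    then have "(\<Union>i. A i) \<inter> D = (\<Union>i. A' i) \<inter> D" by blast
    with A'(1) show ?case by (intro bexI[of _ "\<Union>i. A' i"]) auto
  qed
qed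

text \<open>Values outside the support have probability 0, and there are only countably many of
  them.\<close>

lemma (in prob_space) AE_in_discrete_support:
  assumes [measurable]: "X \<in> measurable M (count_space UNIV)"
  shows "AE \<omega> in M. X \<omega> \<in> discrete_support M X"
proof -
  have "AE \<omega> in M. X \<omega> \<noteq> j" if "j \<notin> discrete_support M X" for j
  proof -
    have "prob {\<omega> \<in> space M. X \<omega> = j} = 0"
      using that zero_less_measure_iff[of M] by (simp add: discrete_support_def)
    moreover have "{\<omega> \<in> space M. X \<omega> = j} \<in> events" by measurable
    ultimately have "AE \<omega> in M. \<omega> \<notin> {\<omega> \<in> space M. X \<omega> = j}" by (subst (asm) prob_eq_0)
    with AE_space show ?thesis by eventually_elim auto
  qed
  then have "AE \<omega> in M. \<forall>j. j \<notin> discrete_support M X \<longrightarrow> X \<omega> \<noteq> j"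
    by (subst AE_all_countable) auto
  then show ?thesis by eventually_elim auto
qed

section \<open>The filter equation, first at a fixed time and on a fixed jump event\<close>

theorem proposition5:
  fixes M :: "'a measure"
    and \<Gamma> :: nat
    and F :: "nat \<Rightarrow> 'a measure"
    and N :: "nat \<Rightarrow> 'a \<Rightarrow> nat"
    and J :: "nat set"
    and \<Theta> A Mart :: "nat \<Rightarrow> 'a \<Rightarrow> real"
  assumes "prob_space M"
    and "filtration_upto M \<Gamma> F"
    and "counting_process_upto M \<Gamma> F N"
    and "\<forall>n\<in>{1..\<Gamma>}. discrete_support M (jump N n) = J"
    and "0 \<in> J"
    and "adapted_upto \<Gamma> F borel \<Theta>"
    and "square_integrable_upto M \<Gamma> \<Theta>"
    and "\<forall>n\<in>{1..\<Gamma>}. cond_indep_var M (F (n - 1)) borel (\<Theta> n) (count_space UNIV) (jump N n)"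
    and "predictable_upto \<Gamma> F A"
    and "square_integrable_upto M \<Gamma> A"
    and "martingale_upto M \<Gamma> F Mart"
    and "square_integrable_upto M \<Gamma> Mart"
    and "\<forall>n\<le>\<Gamma>. AE \<omega> in M. \<Theta> n \<omega> = A n \<omega> + Mart n \<omega>"
  shows "AE \<omega> in M. \<forall>n\<in>{1..\<Gamma>}.
    filtered M N \<Theta> n \<omega> =
      (\<Sum>\<^sub>\<infinity>j\<in>J.
         filtered M N (\<lambda>m \<omega>. predicted M F \<Theta> m \<omega> * jump_intensity M F N j m \<omega>) (n - 1) \<omega> /
         filtered M N (jump_intensity M F N j) (n - 1) \<omega> *
         indicator {\<omega> \<in> space M. jump N n \<omega> = j} \<omega>)"
proof -
  interpret prob_space M by fact
  note defs = filtration_upto_def adapted_upto_def counting_process_upto_def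
    square_integrable_upto_def
  have "AE \<omega> in M. filtered M N \<Theta> n \<omega> =
      (\<Sum>\<^sub>\<infinity>j\<in>J.
         filtered M N (\<lambda>m \<omega>. predicted M F \<Theta> m \<omega> * jump_intensity M F N j m \<omega>) (n - 1) \<omega> /
         filtered M N (jump_intensity M F N j) (n - 1) \<omega> *
         indicator {\<omega> \<in> space M. jump N n \<omega> = j} \<omega>)" if n: "n \<in> {1..\<Gamma>}" for n
  proof -
    \<comment> \<open>\<open>m\<close> is the subscript \<open>n - 1\<close> of the prediction and
      of the intensities.\<close>
    obtain m where m: "n = Suc m" "Suc m \<le> \<Gamma>" using n by (cases n) auto
    define D where "D j = {\<omega> \<in> space M. jump N (Suc m) \<omega> = j}" for j
    let ?G = "augmented_natural_filtration M N m"
    let ?H = "augmented_natural_filtration M N (Suc m)"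
    have F: "subalgebra M (F m)" using assms(2) m by (simp add: defs)
    have NF: "N k \<in> measurable (F m) (count_space UNIV)" if "k \<le> m" for k
    proof -
      have "subalgebra (F m) (F k)" "N k \<in> measurable (F k) (count_space UNIV)"
        using assms(2,3) m that by (simp_all add: defs)
      then show ?thesis by (rule measurable_from_subalg)
    qed
    have NM: "N k \<in> measurable M (count_space UNIV)" if "k \<le> Suc m" for k
    proof -
      have "subalgebra M (F k)" "N k \<in> measurable (F k) (count_space UNIV)"
        using assms(2,3) m that by (simp_all add: defs)
      then show ?thesis by (rule measurable_from_subalg)
    qed
    have mono: "N m \<omega> \<le> N (Suc m) \<omega>" if "\<omega> \<in> space M" for \<omega>
    proof -
      have "\<forall>k\<in>{1..\<Gamma>}. N (k - 1) \<omega> \<le> N k \<omega>" using assms(3) that by (simp add: defs)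
      from bspec[OF this, of "Suc m"] show ?thesis using m by simp
    qed
    have G: "subalgebra M ?G" and H: "subalgebra M ?H" and GH: "subalgebra ?H ?G"
      using NM by (auto intro!: subalgebra_augmented_natural_filtration
          subalgebra_augmented_natural_filtration_mono)
    have [measurable]: "N m \<in> measurable ?H (count_space UNIV)"
      "N (Suc m) \<in> measurable ?H (count_space UNIV)"
      by (auto intro!: measurable_augmented_natural_filtration)
    have jH: "jump N (Suc m) \<in> measurable ?H (count_space UNIV)"
    proof -
      have "(\<lambda>\<omega>. N (Suc m) \<omega> - N m \<omega>) \<in> measurable ?H (count_space UNIV)" by measurable
      then show ?thesis by (simp add: jump_def[abs_def])
    qed
    have jM: "jump N (Suc m) \<in> measurable M (count_space UNIV)"
      by (rule measurable_from_subalg[OF H jH])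
    have DH: "D j \<in> sets ?H" for j
    proof -
      have "jump N (Suc m) -` {j} \<inter> space ?H \<in> sets ?H" by (rule measurable_sets[OF jH]) simp
      also have "jump N (Suc m) -` {j} \<inter> space ?H = D j"
        by (auto simp: D_def space_augmented_natural_filtration)
      finally show ?thesis .
    qed
    have DM: "D j \<in> sets M" for j using DH H by (auto simp: subalgebra_def)
    \<comment> \<open>Square integrability gives integrability because the measure is
      finite.\<close>
    have \<Theta>: "integrable M (\<Theta> (Suc m))"
      using assms(7) m square_integrable_imp_integrable[of "\<Theta> (Suc m)"] by (simp add: defs)
    have ind: "cond_indep_var M (F m) borel (\<Theta> (Suc m)) (count_space UNIV) (jump N (Suc m))"
      using bspec[OF assms(8) n] by (simp add: m(1))
    have D_eq: "{\<omega> \<in> space M. jump N (Suc m) \<omega> \<in> {j}} = D j" for j by (auto simp: D_def)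
    have key: "AE \<omega> in M. \<omega> \<in> D j \<longrightarrow> filtered M N \<Theta> (Suc m) \<omega> =
         filtered M N (\<lambda>m \<omega>. predicted M F \<Theta> m \<omega> * jump_intensity M F N j m \<omega>) m \<omega> /
         filtered M N (jump_intensity M F N j) m \<omega>" for j
    proof -
      interpret G: sigma_finite_subalgebra M ?G by (rule sigma_finite_subalgebraI[OF G])
      have "{j} \<in> sets (count_space UNIV)" by simp
      note mult = cond_indep_var_real_cond_exp_mult[OF F ind \<Theta> this, unfolded D_eq]
      have D\<Theta>: "integrable M (\<lambda>x. indicator (D j) x * \<Theta> (Suc m) x)"
        using integrable_real_mult_indicator[OF DM \<Theta>] by (simp add: mult.commute)
      have iD: "integrable M (indicator (D j) :: 'a \<Rightarrow> real)" using DM by (simp add: less_top[symmetric])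
      note mod_null = augmented_natural_filtration_mod_null[OF F NF]
      have bayes: "AE x in M. x \<in> D j \<longrightarrow> real_cond_exp M ?H (\<Theta> (Suc m)) x =
        real_cond_exp M ?G (\<lambda>x. indicator (D j) x * \<Theta> (Suc m) x) x
          / real_cond_exp M ?G (indicator (D j)) x"
        by (rule real_cond_exp_bayes_trace[OF G H GH DH _ \<Theta>])
          (unfold D_def, rule augmented_natural_filtration_trace[OF mono])
      \<comment> \<open>Conditioning on \<open>F m\<close> is inserted in the numerator and then in
        the denominator of \<open>bayes\<close>. In the numerator \<open>mult\<close> splits the
        inner conditional expectation into prediction times intensity.\<close>
      have "AE x in M. real_cond_exp M ?G (real_cond_exp M (F m) (\<lambda>x. indicator (D j) x * \<Theta> (Suc m) x)) x
          = real_cond_exp M ?G (\<lambda>x. indicator (D j) x * \<Theta> (Suc m) x) x"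
        by (rule real_cond_exp_nested_mod_null[OF F G mod_null D\<Theta>])
      moreover have "AE x in M. real_cond_exp M ?G (real_cond_exp M (F m) (indicator (D j))) x
          = real_cond_exp M ?G (indicator (D j)) x"
        by (rule real_cond_exp_nested_mod_null[OF F G mod_null iD])
      moreover have "AE x in M. real_cond_exp M ?G (real_cond_exp M (F m) (\<lambda>x. indicator (D j) x * \<Theta> (Suc m) x)) x
          = real_cond_exp M ?G (\<lambda>x. real_cond_exp M (F m) (\<Theta> (Suc m)) x * real_cond_exp M (F m) (indicator (D j)) x) x"
        by (rule G.real_cond_exp_cong[OF mult]) auto
      ultimately show ?thesis
        using bayes unfolding filtered_def predicted_def jump_intensity_def D_def[symmetric]
        by eventually_elim simp
    qed
    have "AE \<omega> in M. jump N (Suc m) \<omega> \<in> J"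
      using AE_in_discrete_support[OF jM] assms(4) n m by auto
    \<comment> \<open>The jump sizes are countable, so one null set serves all
      \<open>j\<close>.\<close>
    moreover have "AE \<omega> in M. \<forall>j. \<omega> \<in> D j \<longrightarrow> filtered M N \<Theta> (Suc m) \<omega> =
         filtered M N (\<lambda>m \<omega>. predicted M F \<Theta> m \<omega> * jump_intensity M F N j m \<omega>) m \<omega> /
         filtered M N (jump_intensity M F N j) m \<omega>"
      using key by (subst AE_all_countable) blast
    ultimately show ?thesis
      using AE_space
    proof eventually_elim
      case (elim \<omega>)
      let ?j = "jump N (Suc m) \<omega>"
      let ?q = "\<lambda>j. filtered M N (\<lambda>m \<omega>. predicted M F \<Theta> m \<omega> * jump_intensity M F N j m \<omega>) m \<omega> /
         filtered M N (jump_intensity M F N j) m \<omega>"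
      \<comment> \<open>At a fixed \<open>\<omega>\<close> every term except that of the actual jump
        \<open>?j \<in> J\<close> vanishes. The sum therefore has at most one nonzero term, and the
        default value of \<open>infsum\<close> for divergent sums never arises.\<close>
      have "(\<Sum>\<^sub>\<infinity>j\<in>J. ?q j * indicator (D j) \<omega>) = (\<Sum>\<^sub>\<infinity>j\<in>{?j}. ?q j * indicator (D j) \<omega>)"
        by (rule infsum_cong_neutral) (use elim(1) in \<open>auto simp: D_def\<close>)
      also have "\<dots> = ?q ?j" using elim(3) by (simp add: D_def)
      also have "\<dots> = filtered M N \<Theta> (Suc m) \<omega>" using elim(2,3) by (simp add: D_def)
      finally show ?case by (simp add: m D_def)
    qed
  qed
  \<comment> \<open>The exceptional sets of the finitely many times are united.\<close>
  then show ?thesis by (subst AE_ball_countable) auto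
qed

end
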